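(* Let $(K,P)$ be a random element of $H\times L$ that is space-homogeneous stationary, i.e. $\theta_s(K,P)\overset{d}{=}(K,P)$ for all $s\in\mathbb{R}$. Let $l_n=P_n-P_{n-1}$ for $n\in\mathbb{Z}$, let $N_t=n$ for $t\in(P_{n-1},P_n]$, let $U_t=\frac{t-P_{N_t-1}}{l_{N_t}}$ be the relative position of $t$ in its cycle, and let $(K^\circ,P^\circ)=\theta_{P_0}(K,P)=((K_{t+P_0}-K_{P_0})_{t\in\mathbb{R}},(P_k-P_0)_{k\in\mathbb{Z}})$. Then the random variable $U_0$ is uniform on $[0,1)$ and is independent of $(K^\circ,P^\circ)$. Also, for every $t\ge0$ and every nonnegative $\mathcal{H}\otimes\mathcal{L}$-measurable function $f$, $$\mathbb{E}\left[\sum_{k=1}^{N_t}f(\theta_{P_k}(K,P))\right]=t\,\mathbb{E}\left[\frac{f(K^\circ,P^\circ)}{l_0}\right].$$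
   Context: $H$ is the space of real-valued càdlàg functions $z=(z_t)_{t\in\mathbb{R}}$ with $z_0=0$, with the $\sigma$-field $\mathcal{H}$ generated by the coordinate maps. $L$ is the space of sequences $(s_k)_{k\in\mathbb{Z}}\in\mathbb{R}^{\mathbb{Z}}$ with $-\infty\leftarrow\cdots<s_{-1}<0\le s_0<s_1<\cdots\to\infty$, with the trace $\mathcal{L}$ of the product $\sigma$-field. For $t\in\mathbb{R}$ the shift $\theta_t:H\times L\to H\times L$ is $$\theta_t((z_s)_{s\in\mathbb{R}},(s_k)_{k\in\mathbb{Z}})=((z_{t+s}-z_t)_{s\in\mathbb{R}},(s_{n_t+k}-t)_{k\in\mathbb{Z}}),$$ where $n_t=n$ if and only if $t\in(s_{n-1},s_n]$. An empty sum is $0$. *)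

theory Defs
  imports "HOL-Probability.Probability"
begin

definition cadlag :: "(real \<Rightarrow> real) \<Rightarrow> bool" where
  "cadlag z \<longleftrightarrow> (\<forall>t. continuous (at_right t) z \<and> (\<exists>l. (z \<longlongrightarrow> l) (at_left t)))"

definition H_space :: "(real \<Rightarrow> real) set" where
  "H_space = {z. cadlag z \<and> z 0 = 0}"

definition H_measure :: "(real \<Rightarrow> real) measure" where
  "H_measure = sigma H_space {{z \<in> H_space. z t \<in> B} | t B. B \<in> sets borel}"

definition L_space :: "(int \<Rightarrow> real) set" where
  "L_space = {s. strict_mono s \<and> s (-1) < 0 \<and> 0 \<le> s 0 \<and>
     filterlim s at_top at_top \<and> filterlim s at_bot at_bot}"

definition L_measure :: "(int \<Rightarrow> real) measure" where
  "L_measure = restrict_space (PiM UNIV (\<lambda>_. borel)) L_space"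

abbreviation HL_measure :: "((real \<Rightarrow> real) \<times> (int \<Rightarrow> real)) measure" where
  "HL_measure \<equiv> H_measure \<Otimes>\<^sub>M L_measure"

definition cycle_index :: "(int \<Rightarrow> real) \<Rightarrow> real \<Rightarrow> int" where
  "cycle_index s t = (THE n. t \<in> {s (n - 1)<..s n})"

lemma cycle_index_eq_iff:
  assumes "s \<in> L_space"
  shows "cycle_index s t = n \<longleftrightarrow> t \<in> {s (n - 1)<..s n}"
proof -
  have mono: "strict_mono s" and top: "filterlim s at_top at_top" and bot: "filterlim s at_bot at_bot"
    using assms by (auto simp: L_space_def)
  have "\<exists>n. t \<in> {s (n - 1)<..s n}"
  proof -
    have "eventually (\<lambda>n. t \<le> s n) at_top"
      using top by (simp add: filterlim_at_top)
    then obtain a where a: "t \<le> s a"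
      by (auto simp: eventually_at_top_linorder)
    have "eventually (\<lambda>n. s n < t) at_bot"
      using bot by (simp add: filterlim_at_bot_dense)
    then obtain b where b: "s b < t"
      by (auto simp: eventually_at_bot_linorder)
    have "b < a"
      using a b strict_mono_less[OF mono, of b a] by linarith
    then have ex: "t \<le> s (b + int (nat (a - b)))"
      using a by simp
    define k where "k = (LEAST k. t \<le> s (b + int k))"
    have k: "t \<le> s (b + int k)"
      unfolding k_def using ex by (rule LeastI)
    have "k \<noteq> 0"
      using k b by (intro notI) simp
    then have "\<not> t \<le> s (b + int (k - 1))"
      unfolding k_def by (intro not_less_Least) (simp add: k_def)
    moreover have "b + int (k - 1) = b + int k - 1"
      using \<open>k \<noteq> 0\<close> by simp
    ultimately have "\<not> t \<le> s (b + int k - 1)"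
      by metis
    then show ?thesis
      using k by (intro exI[of _ "b + int k"]) (simp add: add_diff_eq)
  qed
  moreover have "m = n" if "t \<in> {s (m - 1)<..s m}" "t \<in> {s (n - 1)<..s n}" for m n
  proof -
    have "s (m - 1) < s n" "s (n - 1) < s m"
      using that by auto
    then show ?thesis
      using strict_mono_less[OF mono] by simp
  qed
  ultimately have "\<exists>!n. t \<in> {s (n - 1)<..s n}"
    by blast
  from the1_equality[OF this] theI'[OF this] show ?thesis
    unfolding cycle_index_def by metis
qed

definition theta :: "real \<Rightarrow> (real \<Rightarrow> real) \<times> (int \<Rightarrow> real) \<Rightarrow> (real \<Rightarrow> real) \<times> (int \<Rightarrow> real)" where
  "theta t = (\<lambda>(z, s). (\<lambda>r. z (t + r) - z t, \<lambda>k. s (cycle_index s t + k) - t))"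

lemma space_H_measure: "space H_measure = H_space"
  unfolding H_measure_def by (intro space_measure_of) auto

lemma space_L_measure: "space L_measure = L_space"
  unfolding L_measure_def by (simp add: space_restrict_space space_PiM)

lemma measurable_H_coord [measurable]: "(\<lambda>z. z t) \<in> borel_measurable H_measure"
proof (rule measurableI)
  fix B :: "real set" assume "B \<in> sets borel"
  then have "{z \<in> H_space. z t \<in> B} \<in> {{z \<in> H_space. z t \<in> B} | t B. B \<in> sets borel}"
    by blast
  then have "{z \<in> H_space. z t \<in> B} \<in> sets H_measure"
    unfolding H_measure_def by (subst sets_measure_of) auto
  moreover have "(\<lambda>z. z t) -` B \<inter> space H_measure = {z \<in> H_space. z t \<in> B}"
    by (auto simp: space_H_measure)
  ultimately show "(\<lambda>z. z t) -` B \<inter> space H_measure \<in> sets H_measure"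
    by simp
qed auto

lemma measurable_L_coord [measurable]: "(\<lambda>s. s k) \<in> borel_measurable L_measure"
  unfolding L_measure_def by (intro measurable_restrict_space1 measurable_component_singleton) auto

lemma theta_in_HL_space:
  assumes "z \<in> H_space" "s \<in> L_space"
  shows "theta t (z, s) \<in> H_space \<times> L_space"
proof -
  have lim: "filterlim (\<lambda>u. t + u) (at_right (t + r)) (at_right r)"
            "filterlim (\<lambda>u. t + u) (at_left (t + r)) (at_left r)" for r
    by (auto simp: filterlim_at eventually_at_filter intro!: tendsto_intros)
  have "continuous (at_right r) (\<lambda>u. z (t + u) - z t)" for r
  proof -
    have "(z \<longlongrightarrow> z (t + r)) (at_right (t + r))"
      using assms by (auto simp: H_space_def cadlag_def continuous_within)
    from filterlim_compose[OF this lim(1)] show ?thesis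
      unfolding continuous_within by (intro tendsto_intros)
  qed
  moreover have "\<exists>l. ((\<lambda>u. z (t + u) - z t) \<longlongrightarrow> l) (at_left r)" for r
  proof -
    obtain l where "(z \<longlongrightarrow> l) (at_left (t + r))"
      using assms by (auto simp: H_space_def cadlag_def)
    from filterlim_compose[OF this lim(2)] show ?thesis
      by (intro exI[of _ "l - z t"] tendsto_intros)
  qed
  ultimately have 1: "(\<lambda>u. z (t + u) - z t) \<in> H_space"
    by (simp add: H_space_def cadlag_def)
  define n where "n = cycle_index s t"
  have n: "s (n - 1) < t" "t \<le> s n"
    using cycle_index_eq_iff[OF assms(2), of t n] by (auto simp: n_def)
  have L: "strict_mono s" "filterlim s at_top at_top" "filterlim s at_bot at_bot"
    using assms(2) by (auto simp: L_space_def)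
  have at: "filterlim (\<lambda>k. n + k) at_top at_top" "filterlim (\<lambda>k. n + k) at_bot at_bot"
    unfolding filterlim_at_top filterlim_at_bot eventually_at_top_linorder eventually_at_bot_linorder
    by (metis add.commute diff_le_eq, metis add.commute le_diff_eq)
  have "filterlim (\<lambda>k. s (n + k) - t) at_top at_top"
    using filterlim_compose[OF L(2) at(1)] unfolding filterlim_at_top by (simp add: le_diff_eq)
  moreover have "filterlim (\<lambda>k. s (n + k) - t) at_bot at_bot"
    using filterlim_compose[OF L(3) at(2)] unfolding filterlim_at_bot by (simp add: diff_le_eq)
  ultimately have "(\<lambda>k. s (n + k) - t) \<in> L_space"
    using n L(1) by (auto simp: L_space_def strict_mono_def)
  with 1 show ?thesis
    by (simp add: theta_def n_def)
qed

lemma measurable_cycle_index [measurable]: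
  "(\<lambda>s. cycle_index s t) \<in> measurable L_measure (count_space UNIV)"
proof (rule measurable_count_space_eq2_countable[THEN iffD2, rule_format], safe)
  fix n :: int
  have "(\<lambda>s. cycle_index s t) -` {n} \<inter> space L_measure = {s \<in> space L_measure. s (n - 1) < t \<and> t \<le> s n}"
    using cycle_index_eq_iff by (auto simp: space_L_measure)
  also have "\<dots> \<in> sets L_measure"
    by measurable
  finally show "(\<lambda>s. cycle_index s t) -` {n} \<inter> space L_measure \<in> sets L_measure" .
qed auto

lemma measurable_theta: "theta t \<in> measurable HL_measure HL_measure"
proof (rule measurable_pair)
  have sp: "theta t x \<in> H_space \<times> L_space" if "x \<in> space HL_measure" for x
    using that theta_in_HL_space
    by (cases x) (auto simp: space_pair_measure space_H_measure space_L_measure)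
  show "fst \<circ> theta t \<in> measurable HL_measure H_measure"
    unfolding H_measure_def
  proof (rule measurable_sigma_sets[OF sets_measure_of])
    show "fst \<circ> theta t \<in> space (sigma H_space {{z \<in> H_space. z t \<in> B} |t B. B \<in> sets borel} \<Otimes>\<^sub>M L_measure) \<rightarrow> H_space"
      using sp by (fold H_measure_def) (auto simp: mem_Times_iff)
    fix A assume "A \<in> {{z \<in> H_space. z t \<in> B} | t B. B \<in> sets (borel :: real measure)}"
    then obtain u B where A: "A = {z \<in> H_space. z u \<in> B}" and [measurable]: "B \<in> sets borel"
      by blast
    have "(fst \<circ> theta t) -` A \<inter> space HL_measure = {x \<in> space HL_measure. fst x (t + u) - fst x t \<in> B}"
      using sp by (auto simp: A theta_def mem_Times_iff split: prod.splits)
    also have "\<dots> \<in> sets HL_measure"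
      by measurable
    finally show "(fst \<circ> theta t) -` A \<inter> space (sigma H_space {{z \<in> H_space. z t \<in> B} |t B. B \<in> sets borel} \<Otimes>\<^sub>M L_measure)
        \<in> sets (sigma H_space {{z \<in> H_space. z t \<in> B} |t B. B \<in> sets borel} \<Otimes>\<^sub>M L_measure)"
      by (fold H_measure_def)
  qed auto
  have "(\<lambda>x. snd (theta t x) k) \<in> borel_measurable HL_measure" for k
  proof -
    have "(\<lambda>x. snd x (n + k) - t) \<in> borel_measurable HL_measure" for n
      by measurable
    moreover have "(\<lambda>x. cycle_index (snd x) t) \<in> measurable HL_measure (count_space UNIV)"
      by (rule measurable_compose[OF measurable_snd measurable_cycle_index])
    ultimately have "(\<lambda>x. snd x (cycle_index (snd x) t + k) - t) \<in> borel_measurable HL_measure"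
      by (rule measurable_compose_countable[where f = "\<lambda>n x. snd x (n + k) - t"])
    then show ?thesis
      by (simp add: theta_def split_beta)
  qed
  then have "(\<lambda>x. snd (theta t x)) \<in> measurable HL_measure (PiM UNIV (\<lambda>_. borel))"
    by (intro measurable_PiM_single') (auto simp: space_PiM)
  then show "snd \<circ> theta t \<in> measurable HL_measure L_measure"
    unfolding L_measure_def comp_def
    by (intro measurable_restrict_space2) (use sp in \<open>auto simp: mem_Times_iff L_measure_def\<close>)
qed

definition cycle_length :: "(int \<Rightarrow> real) \<Rightarrow> int \<Rightarrow> real" where
  "cycle_length s n = s n - s (n - 1)"

definition rel_pos :: "(int \<Rightarrow> real) \<Rightarrow> real \<Rightarrow> real" where
  "rel_pos s t = (t - s (cycle_index s t - 1)) / cycle_length s (cycle_index s t)"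

text \<open>The library's \<^const>\<open>prob_space.indep_var\<close> forces both random variables to have the same
  value type; this is the formula of \<open>prob_space.indep_var_eq\<close> without that restriction.\<close>

definition indep_rvs :: "'a measure \<Rightarrow> 'b measure \<Rightarrow> ('a \<Rightarrow> 'b) \<Rightarrow> 'c measure \<Rightarrow> ('a \<Rightarrow> 'c) \<Rightarrow> bool" where
  "indep_rvs M S X T Y \<longleftrightarrow> X \<in> measurable M S \<and> Y \<in> measurable M T \<and>
     prob_space.indep_set M
       (sigma_sets (space M) {X -` A \<inter> space M | A. A \<in> sets S})
       (sigma_sets (space M) {Y -` A \<inter> space M | A. A \<in> sets T})"

text \<open>\<open>distr\<close> is the law only for measurable maps.  By \<open>measurable_theta\<close>
  both sides below are laws as soon as \<open>(K, P)\<close> is a random element.\<close>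

definition space_homogeneous_stationary ::
    "'a measure \<Rightarrow> ('a \<Rightarrow> real \<Rightarrow> real) \<Rightarrow> ('a \<Rightarrow> int \<Rightarrow> real) \<Rightarrow> bool" where
  "space_homogeneous_stationary M K P \<longleftrightarrow>
     (\<forall>t. distr M HL_measure (\<lambda>\<omega>. theta t (K \<omega>, P \<omega>)) = distr M HL_measure (\<lambda>\<omega>. (K \<omega>, P \<omega>)))"

end

theory Submission
  imports Defs
begin

text \<open>
  Everything follows from one exchange formula. Write \<open>X = (K, P)\<close>, let \<open>X\<^sub>n\<close> be \<open>X\<close> seen from
  its point \<open>P\<^sub>n\<close> (so \<open>X\<^sub>0\<close> is the process with the origin moved to \<open>P\<^sub>0\<close>), and let
  \<open>w, v \<ge> 0\<close> be measurable. For any fixed integer \<open>j\<close>,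
  \<open>(\<integral> w(s) ds) E v(P\<^sub>0, X\<^sub>0)\<close> is the integral over \<open>s\<close> of \<open>E[w(s + P\<^sub>j) v(P\<^sub>0, X\<^sub>0)]\<close>, because
  translating \<open>w\<close> does not change its integral. By stationarity \<open>X\<close> may be replaced, separately
  for each \<open>s\<close>, by its shift by \<open>s\<close>. If \<open>s\<close> lies in the cycle ending at \<open>P\<^sub>n\<close>, the shifted
  element has its point number \<open>j\<close> at \<open>P\<^bsub>n+j\<^esub> - s\<close>, its point number \<open>0\<close> at \<open>P\<^sub>n - s\<close>, and seen
  from the latter it is \<open>X\<^sub>n\<close>. So \<open>w\<close> is evaluated at \<open>P\<^bsub>n+j\<^esub>\<close>, which is constant in \<open>s\<close>
  along the cycle, and the substitution \<open>u = P\<^sub>n - s\<close> gives \<open>cycle_exchange\<close>: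
  \<open>(\<integral> w(s) ds) E v(P\<^sub>0, X\<^sub>0) = E \<Sum>\<^sub>n w(P\<^bsub>n+j\<^esub>) V(X\<^sub>n)\<close>, where \<open>V(x)\<close> is the integral of
  \<open>v(u, x)\<close> over \<open>u\<close> from \<open>0\<close> to the length of the cycle number \<open>0\<close> of \<open>x\<close>.

  The function \<open>v\<close> enters the right-hand side only through \<open>V\<close>. Two choices give the theorem.
  With \<open>v(u, x) = f(x) / l\<^sub>0(x)\<close> one has \<open>V = f\<close>; taking for \<open>w\<close> the indicator of \<open>[0,t)\<close> and
  \<open>j = -1\<close> selects the \<open>n\<close> with \<open>P\<^bsub>n-1\<^esub> \<in> [0,t)\<close>, which are exactly \<open>1, \<dots>, N\<^sub>t\<close>: this is
  \<open>campbell_formula\<close>.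
  Since the relative position is \<open>U\<^sub>0 = 1 - P\<^sub>0 / l\<^sub>0\<close>, the function
  \<open>v(u, x) = 1\<^sub>A(1 - u / l\<^sub>0(x)) 1\<^sub>B(x)\<close> describes the event \<open>U\<^sub>0 \<in> A, X\<^sub>0 \<in> B\<close>. It has the same \<open>V\<close> as
  \<open>\<lambda>(A \<inter> [0,1)) 1\<^sub>B(x)\<close>, with \<open>\<lambda>\<close> the Lebesgue measure, so the probability of the event factorises:
  this is \<open>rel_pos_factorises\<close>.

  The price of integrating over the shift is that the shift must be measurable jointly in
  the time and the path; that is where right-continuity of the paths enters.
\<close>

section \<open>Measurability in time and path jointly\<close>

text \<open>
  The coordinate maps are measurable for each fixed time only. Evaluation at a variable time
  \<open>t\<close> is the limit of evaluations at the next strictly larger point of the grid of mesh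
  \<open>1 / (i + 1)\<close>; by right-continuity these converge, and each of them takes
  only countably many times.
\<close>

lemma measurable_path_evaluation:
  "(\<lambda>(t, z). z t) \<in> borel_measurable (borel \<Otimes>\<^sub>M H_measure)"
proof (rule borel_measurable_LIMSEQ_real)
  define a :: "nat \<Rightarrow> real \<Rightarrow> real" where
    "a i t = (of_int \<lfloor>t * real (Suc i)\<rfloor> + 1) / real (Suc i)" for i t
  show "(\<lambda>i. case x of (t, z) \<Rightarrow> z (a i t)) \<longlonglongrightarrow> (case x of (t, z) \<Rightarrow> z t)"
    if "x \<in> space (borel \<Otimes>\<^sub>M H_measure)" for x
  proof -
    obtain t z where x: "x = (t, z)" by (cases x)
    with that have "z \<in> H_space"
      by (simp add: space_pair_measure space_H_measure)
    then have right: "(z \<longlongrightarrow> z t) (at_right t)"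
      by (simp add: H_space_def cadlag_def continuous_within)
    \<comment> \<open>Strictly above \<open>t\<close>, so that only the limit from the right is used.\<close>
    have gt: "t < a i t" and le: "a i t \<le> t + 1 / real (Suc i)" for i
    proof -
      have "t * real (Suc i) < of_int \<lfloor>t * real (Suc i)\<rfloor> + 1"
        by linarith
      then show "t < a i t"
        by (simp add: a_def pos_less_divide_eq)
      have "of_int \<lfloor>t * real (Suc i)\<rfloor> + 1 \<le> t * real (Suc i) + 1"
        by linarith
      then have "a i t \<le> (t * real (Suc i) + 1) / real (Suc i)"
        unfolding a_def by (intro divide_right_mono) auto
      also have "\<dots> = t + 1 / real (Suc i)"
        by (simp add: add_divide_distrib)
      finally show "a i t \<le> t + 1 / real (Suc i)" .
    qed
    have "(\<lambda>i. t + 1 / real (Suc i)) \<longlonglongrightarrow> t + 0"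
      by (intro tendsto_intros LIMSEQ_Suc[OF lim_1_over_n])
    then have up: "(\<lambda>i. t + 1 / real (Suc i)) \<longlonglongrightarrow> t" by simp
    have "(\<lambda>i. a i t) \<longlonglongrightarrow> t"
      by (rule tendsto_sandwich[OF _ _ tendsto_const up])
        (use less_imp_le[OF gt] le in \<open>simp_all add: always_eventually\<close>)
    then have "filterlim (\<lambda>i. a i t) (at_right t) sequentially"
      using gt by (auto simp: filterlim_at intro!: always_eventually dest: less_imp_neq) (metis less_irrefl)
    from filterlim_compose[OF right this] show ?thesis
      by (simp add: x)
  qed
  show "(\<lambda>x. case x of (t, z) \<Rightarrow> z (a i t)) \<in> borel_measurable (borel \<Otimes>\<^sub>M H_measure)" for i
  proof -
    have "(\<lambda>x. snd x ((of_int k + 1) / real (Suc i))) \<in> borel_measurable (borel \<Otimes>\<^sub>M H_measure)"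
      for k :: int
      by (rule measurable_compose[OF measurable_snd measurable_H_coord])
    moreover have "(\<lambda>x. \<lfloor>fst x * real (Suc i)\<rfloor>)
        \<in> measurable (borel \<Otimes>\<^sub>M H_measure) (count_space UNIV)"
      by measurable
    ultimately have "(\<lambda>x. snd x ((of_int \<lfloor>fst x * real (Suc i)\<rfloor> + 1) / real (Suc i)))
        \<in> borel_measurable (borel \<Otimes>\<^sub>M H_measure)"
      by (rule measurable_compose_countable
          [where f = "\<lambda>k x. snd x ((of_int k + 1) / real (Suc i))"])
    then show ?thesis
      by (simp add: a_def split_beta')
  qed
qed

text \<open>
  The conclusion matches almost any measurability goal, so the rule is kept out of the
  measurability prover and is always applied with an explicit path.
\<close>

lemma measurable_path_at:
  assumes "t \<in> borel_measurable M" "z \<in> measurable M H_measure"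
  shows "(\<lambda>x. z x (t x)) \<in> borel_measurable M"
  using measurable_compose[OF measurable_Pair[OF assms] measurable_path_evaluation] by simp

lemma measurable_cycle_index_joint:
  "(\<lambda>(t, s). cycle_index s t) \<in> measurable (borel \<Otimes>\<^sub>M L_measure) (count_space UNIV)"
proof (rule measurable_count_space_eq2_countable[THEN iffD2, rule_format], safe)
  fix n :: int
  have "(\<lambda>(t, s). cycle_index s t) -` {n} \<inter> space (borel \<Otimes>\<^sub>M L_measure) =
      {x \<in> space (borel \<Otimes>\<^sub>M L_measure). snd x (n - 1) < fst x \<and> fst x \<le> snd x n}"
    using cycle_index_eq_iff by (fastforce simp: space_pair_measure space_L_measure)
  also have "\<dots> \<in> sets (borel \<Otimes>\<^sub>M L_measure)"
    by measurable
  finally show "(\<lambda>(t, s). cycle_index s t) -` {n} \<inter> space (borel \<Otimes>\<^sub>M L_measure)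
      \<in> sets (borel \<Otimes>\<^sub>M L_measure)" .
qed auto

lemma measurable_into_H_measure:
  assumes space: "\<And>x. x \<in> space M \<Longrightarrow> g x \<in> H_space"
    and coord: "\<And>t. (\<lambda>x. g x t) \<in> borel_measurable M"
  shows "g \<in> measurable M H_measure"
  unfolding H_measure_def
proof (rule measurable_sigma_sets[OF sets_measure_of])
  fix A assume "A \<in> {{z \<in> H_space. z t \<in> B} | t B. B \<in> sets (borel :: real measure)}"
  then obtain u B where A: "A = {z \<in> H_space. z u \<in> B}" and B: "B \<in> sets borel"
    by blast
  have "g -` A \<inter> space M = (\<lambda>x. g x u) -` B \<inter> space M"
    using space by (auto simp: A)
  also have "\<dots> \<in> sets M"
    using coord B by (rule measurable_sets)
  finally show "g -` A \<inter> space M \<in> sets M" .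
qed (use space in auto)

lemma measurable_into_L_measure:
  assumes "\<And>x. x \<in> space M \<Longrightarrow> g x \<in> L_space"
    and "\<And>k. (\<lambda>x. g x k) \<in> borel_measurable M"
  shows "g \<in> measurable M L_measure"
proof -
  have "g \<in> measurable M (PiM UNIV (\<lambda>_. borel))"
    by (rule measurable_PiM_single'[where f = "\<lambda>k x. g x k"]) (use assms(2) in \<open>auto simp: space_PiM\<close>)
  then show ?thesis
    unfolding L_measure_def
    by (intro measurable_restrict_space2) (use assms(1) in auto)
qed

lemma theta_in_space:
  "x \<in> space HL_measure \<Longrightarrow> theta t x \<in> space HL_measure"
  using theta_in_HL_space
  by (cases x) (auto simp: space_pair_measure space_H_measure space_L_measure)

lemma measurable_theta_joint:
  "(\<lambda>(t, x). theta t x) \<in> measurable (borel \<Otimes>\<^sub>M HL_measure) HL_measure"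
proof (rule measurable_pair)
  let ?S = "(borel :: real measure) \<Otimes>\<^sub>M HL_measure"
  have sp: "fst (theta t x) \<in> H_space" "snd (theta t x) \<in> L_space"
    if "(t, x) \<in> space ?S" for t x
    using that theta_in_space[of x t]
    by (auto simp: space_pair_measure space_H_measure space_L_measure)
  have [measurable]: "(\<lambda>y. fst (snd y)) \<in> measurable ?S H_measure"
    "(\<lambda>y. snd (snd y)) \<in> measurable ?S L_measure"
    by measurable
  show "fst \<circ> (\<lambda>(t, x). theta t x) \<in> measurable ?S H_measure"
  proof (rule measurable_into_H_measure)
    fix r
    have "(\<lambda>y. fst (snd y) (fst y + c)) \<in> borel_measurable ?S" for c
      by (rule measurable_path_at[where z = "\<lambda>y. fst (snd y)"]) measurable
    from borel_measurable_diff[OF this[of r] this[of 0]]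
    have "(\<lambda>y. fst (snd y) (fst y + r) - fst (snd y) (fst y)) \<in> borel_measurable ?S"
      by simp
    then show "(\<lambda>y. (fst \<circ> (\<lambda>(t, x). theta t x)) y r) \<in> borel_measurable ?S"
      by (simp add: theta_def split_beta')
  qed (use sp in auto)
  show "snd \<circ> (\<lambda>(t, x). theta t x) \<in> measurable ?S L_measure"
  proof (rule measurable_into_L_measure)
    fix k
    have "(\<lambda>y. snd (snd y) (n + k) - fst y) \<in> borel_measurable ?S" for n
      by measurable
    moreover have "(\<lambda>y. cycle_index (snd (snd y)) (fst y)) \<in> measurable ?S (count_space UNIV)"
      using measurable_compose[of "\<lambda>y. (fst y, snd (snd y))" ?S "borel \<Otimes>\<^sub>M L_measure",
          OF _ measurable_cycle_index_joint] by simp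
    ultimately have "(\<lambda>y. snd (snd y) (cycle_index (snd (snd y)) (fst y) + k) - fst y)
        \<in> borel_measurable ?S"
      by (rule measurable_compose_countable[where f = "\<lambda>n y. snd (snd y) (n + k) - fst y"])
    then show "(\<lambda>y. (snd \<circ> (\<lambda>(t, x). theta t x)) y k) \<in> borel_measurable ?S"
      by (simp add: theta_def split_beta')
  qed (use sp in auto)
qed

lemma measurable_theta_at [measurable (raw)]:
  assumes "t \<in> borel_measurable M" "g \<in> measurable M HL_measure"
  shows "(\<lambda>x. theta (t x) (g x)) \<in> measurable M HL_measure"
  using measurable_compose[OF measurable_Pair[OF assms] measurable_theta_joint] by simp

lemma measurable_cycle_length [measurable]:
  "(\<lambda>s. cycle_length s n) \<in> borel_measurable L_measure"
  unfolding cycle_length_def by measurable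

section \<open>Viewing a path from its own cycle points\<close>

definition seen_from :: "int \<Rightarrow> (real \<Rightarrow> real) \<times> (int \<Rightarrow> real) \<Rightarrow> (real \<Rightarrow> real) \<times> (int \<Rightarrow> real)"
  where "seen_from n x = theta (snd x n) x"

lemma measurable_seen_from [measurable]: "seen_from n \<in> measurable HL_measure HL_measure"
  unfolding seen_from_def[abs_def] by measurable

lemma cycle_index_point:
  assumes "s \<in> L_space"
  shows "cycle_index s (s n) = n"
  using assms strict_monoD[of s "n - 1" n]
  by (subst cycle_index_eq_iff) (auto simp: L_space_def)

lemma cycle_index_zero:
  assumes "s \<in> L_space"
  shows "cycle_index s 0 = 0"
  using assms by (subst cycle_index_eq_iff) (auto simp: L_space_def)

lemma seen_from_eq:
  assumes "s \<in> L_space"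
  shows "seen_from n (z, s) = (\<lambda>r. z (s n + r) - z (s n), \<lambda>k. s (n + k) - s n)"
  using assms by (simp add: seen_from_def theta_def cycle_index_point)

lemma snd_theta: "snd (theta t (z, s)) j = s (cycle_index s t + j) - t"
  by (simp add: theta_def)

text \<open>
  The origin of the shifted element lies in the cycle that contained \<open>t\<close>, so moving on to
  the right end of that cycle cancels the first shift.
\<close>

lemma seen_from_theta:
  assumes "z \<in> H_space" "s \<in> L_space"
  shows "seen_from 0 (theta t (z, s)) = seen_from (cycle_index s t) (z, s)"
proof -
  have "snd (theta t (z, s)) \<in> L_space"
    using theta_in_HL_space[OF assms, of t] by (auto simp: mem_Times_iff)
  then show ?thesis
    using assms seen_from_eq[of "\<lambda>k. s (cycle_index s t + k) - t" 0]
    by (simp add: theta_def[of t] seen_from_eq fun_eq_iff algebra_simps)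
qed

lemma cycle_length_pos:
  assumes "s \<in> L_space"
  shows "0 < cycle_length s n"
  using assms strict_monoD[of s "n - 1" n] by (auto simp: L_space_def cycle_length_def)

lemma cycle_length_seen_from:
  assumes "s \<in> L_space"
  shows "cycle_length (snd (seen_from n (z, s))) 0 = cycle_length s n"
  using assms by (simp add: seen_from_eq cycle_length_def)

lemma rel_pos_zero:
  assumes "s \<in> L_space"
  shows "rel_pos s 0 = 1 - s 0 / cycle_length s 0"
  using cycle_length_pos[OF assms, of 0]
  by (simp add: rel_pos_def cycle_index_zero[OF assms] cycle_length_def field_simps)

section \<open>Exchanging a time average for a sum over cycles\<close>

text \<open>
  Each \<open>t\<close> lies in exactly one cycle. Inside a cycle the new variable is the distance
  \<open>u = s\<^sub>n - t\<close> to the right end; cycles are open on the left and closed on the right, hence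
  \<open>u\<close> runs through an interval closed at \<open>0\<close> and open at the length.
\<close>

lemma nn_integral_cut_at_cycles:
  assumes s: "s \<in> L_space" and g: "\<And>n. g n \<in> borel_measurable borel"
  shows "(\<integral>\<^sup>+ t. g (cycle_index s t) t \<partial>lborel) =
    (\<integral>\<^sup>+ n. (\<integral>\<^sup>+ u. g n (s n - u) * indicator {0..<cycle_length s n} u \<partial>lborel) \<partial>count_space UNIV)"
proof -
  have "(\<integral>\<^sup>+ t. g (cycle_index s t) t \<partial>lborel) =
      (\<integral>\<^sup>+ t. (\<integral>\<^sup>+ n. g n t * indicator {s (n - 1)<..s n} t \<partial>count_space UNIV) \<partial>lborel)"
  proof (rule nn_integral_cong)
    fix t
    have "(\<integral>\<^sup>+ n. g n t * indicator {s (n - 1)<..s n} t \<partial>count_space UNIV) =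
        (\<integral>\<^sup>+ n. g n t * indicator {cycle_index s t} n \<partial>count_space UNIV)"
    proof (rule nn_integral_cong)
      fix n
      show "g n t * indicator {s (n - 1)<..s n} t = g n t * indicator {cycle_index s t} n"
        using cycle_index_eq_iff[OF s, of t n] by (auto simp: indicator_def)
    qed
    also have "\<dots> = g (cycle_index s t) t"
      by simp
    finally show "g (cycle_index s t) t =
        (\<integral>\<^sup>+ n. g n t * indicator {s (n - 1)<..s n} t \<partial>count_space UNIV)" ..
  qed
  also have "\<dots> = (\<integral>\<^sup>+ n. (\<integral>\<^sup>+ t. g n t * indicator {s (n - 1)<..s n} t \<partial>lborel) \<partial>count_space UNIV)"
    using g by (intro nn_integral_count_space_nn_integral) auto
  also have "\<dots> = (\<integral>\<^sup>+ n. (\<integral>\<^sup>+ u. g n (s n - u) * indicator {0..<cycle_length s n} u \<partial>lborel) \<partial>count_space UNIV)"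
  proof (rule nn_integral_cong)
    fix n
    have [measurable]: "g n \<in> borel_measurable borel" by (rule g)
    have "(\<integral>\<^sup>+ t. g n t * indicator {s (n - 1)<..s n} t \<partial>lborel) =
        ennreal \<bar>-1\<bar> * (\<integral>\<^sup>+ u. g n (s n + (-1) * u) * indicator {s (n - 1)<..s n} (s n + (-1) * u) \<partial>lborel)"
      by (rule nn_integral_real_affine) auto
    also have "\<dots> = (\<integral>\<^sup>+ u. g n (s n - u) * indicator {0..<cycle_length s n} u \<partial>lborel)"
      by (auto intro!: nn_integral_cong simp: indicator_def cycle_length_def)
    finally show "(\<integral>\<^sup>+ t. g n t * indicator {s (n - 1)<..s n} t \<partial>lborel) =
        (\<integral>\<^sup>+ u. g n (s n - u) * indicator {0..<cycle_length s n} u \<partial>lborel)" .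
  qed
  finally show ?thesis .
qed

text \<open>
  The relative position \<open>1 - u / l\<close> of a point at distance \<open>u\<close> from the right end runs through
  \<open>(0,1]\<close>; the two end points are a null set, which is why \<open>[0,1)\<close> may appear instead.
\<close>

lemma nn_integral_rescaled_cycle:
  assumes A [measurable]: "A \<in> sets borel" and l: "0 < l"
  shows "(\<integral>\<^sup>+ u. indicator A (1 - u / l) * indicator {0..<l} u \<partial>lborel) =
    ennreal l * emeasure lborel (A \<inter> {0..<1})"
proof -
  have "(\<integral>\<^sup>+ u. indicator A (1 - u / l) * indicator {0..<l} u \<partial>lborel) =
      ennreal \<bar>- l\<bar> * (\<integral>\<^sup>+ r. indicator A (1 - (l + - l * r) / l) * indicator {0..<l} (l + - l * r) \<partial>lborel)"
    using l by (intro nn_integral_real_affine) auto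
  also have "\<dots> = ennreal l * (\<integral>\<^sup>+ r. indicator (A \<inter> {0<..1}) r \<partial>lborel)"
  proof (intro arg_cong2[where f = "(*)"] nn_integral_cong)
    fix r :: real
    have "1 - (l + - l * r) / l = r"
      using l by (simp add: field_simps)
    moreover have "l + - l * r \<in> {0..<l} \<longleftrightarrow> r \<in> {0<..1}"
      using l by (auto simp: zero_less_mult_iff mult_le_cancel_left1)
    ultimately show "indicator A (1 - (l + - l * r) / l) * indicator {0..<l} (l + - l * r) =
        (indicator (A \<inter> {0<..1}) r :: ennreal)"
      by (auto simp: indicator_def)
  qed (use l in simp)
  also have "(\<integral>\<^sup>+ r. indicator (A \<inter> {0<..1}) r \<partial>lborel) =
      (\<integral>\<^sup>+ r. indicator (A \<inter> {0..<1}) r \<partial>(lborel :: real measure))"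
  proof (rule nn_integral_cong_AE)
    show "AE r in lborel. indicator (A \<inter> {0<..1}) r = (indicator (A \<inter> {0..<1}) r :: ennreal)"
      using AE_lborel_singleton[of 0] AE_lborel_singleton[of "1 :: real"]
      by eventually_elim (auto simp: indicator_def)
  qed
  finally show ?thesis by simp
qed

text \<open>
  The assertions on \<open>(K, P)\<close> concern only its law, so the canonical space carries
  the argument: the law is a probability measure on \<open>H \<times> L\<close> invariant under all shifts.
\<close>

locale stationary_law = prob_space N
  for N :: "((real \<Rightarrow> real) \<times> (int \<Rightarrow> real)) measure" +
  assumes sets_law [measurable_cong]: "sets N = sets HL_measure"
    and stationary: "\<And>t. distr N HL_measure (theta t) = N"
begin

lemma space_law: "space N = H_space \<times> L_space"
  using sets_eq_imp_space_eq[OF sets_law]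
  by (simp add: space_pair_measure space_H_measure space_L_measure)

lemma nn_integral_theta:
  assumes "f \<in> borel_measurable HL_measure"
  shows "(\<integral>\<^sup>+ x. f (theta t x) \<partial>N) = (\<integral>\<^sup>+ x. f x \<partial>N)"
proof -
  have "(\<integral>\<^sup>+ x. f (theta t x) \<partial>N) = (\<integral>\<^sup>+ x. f x \<partial>distr N HL_measure (theta t))"
    using assms measurable_theta by (intro nn_integral_distr[symmetric]) (auto simp: measurable_cong_sets[OF sets_law])
  then show ?thesis by (simp add: stationary)
qed

text \<open>
  Compare a typical time with a typical cycle: on the left the origin is
  a typical time, on the right every cycle is inspected and \<open>v\<close> is integrated over the
  possible distances \<open>u\<close> from a time in that cycle to its right end. The index shift \<open>j\<close>
  says which point near the cycle is tested by \<open>w\<close>; the left-hand side is the same for all \<open>j\<close>, because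
  it depends on \<open>w\<close> only through its integral.
\<close>

theorem cycle_exchange:
  fixes w :: "real \<Rightarrow> ennreal" and j :: int
  assumes w [measurable]: "w \<in> borel_measurable borel"
    and v [measurable]: "v \<in> borel_measurable (borel \<Otimes>\<^sub>M HL_measure)"
  shows "(\<integral>\<^sup>+ s. w s \<partial>lborel) * (\<integral>\<^sup>+ x. v (snd x 0, seen_from 0 x) \<partial>N) =
    (\<integral>\<^sup>+ x. (\<integral>\<^sup>+ n. w (snd x (n + j)) *
        (\<integral>\<^sup>+ u. v (u, seen_from n x) * indicator {0..<cycle_length (snd x) n} u \<partial>lborel)
      \<partial>count_space UNIV) \<partial>N)"
proof -
  interpret pair_sigma_finite lborel N ..
  define \<Phi> where "\<Phi> s x = w (s + snd x j) * v (snd x 0, seen_from 0 x)" for s x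
  have \<Phi> [measurable]: "case_prod \<Phi> \<in> borel_measurable (borel \<Otimes>\<^sub>M HL_measure)"
    unfolding \<Phi>_def by measurable
  have \<Phi>\<theta>: "(\<lambda>(s, x). \<Phi> s (theta s x)) \<in> borel_measurable (lborel \<Otimes>\<^sub>M N)"
    by measurable
  \<comment> \<open>Tonelli isolates each \<open>s\<close>, stationarity then applies with a shift that depends on \<open>s\<close>.\<close>
  have "(\<integral>\<^sup>+ s. w s \<partial>lborel) * (\<integral>\<^sup>+ x. v (snd x 0, seen_from 0 x) \<partial>N) =
      (\<integral>\<^sup>+ x. (\<integral>\<^sup>+ s. w s \<partial>lborel) * v (snd x 0, seen_from 0 x) \<partial>N)"
    by (rule nn_integral_cmult[symmetric]) measurable
  also have "\<dots> = (\<integral>\<^sup>+ x. (\<integral>\<^sup>+ s. \<Phi> s x \<partial>lborel) \<partial>N)"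
  proof (rule nn_integral_cong)
    fix x :: "(real \<Rightarrow> real) \<times> (int \<Rightarrow> real)"
    have "(\<integral>\<^sup>+ s. w s \<partial>lborel) = (\<integral>\<^sup>+ s. w (s + snd x j) \<partial>lborel)"
      using nn_integral_real_affine[OF w, of 1 "snd x j"] by (simp add: add.commute)
    then show "(\<integral>\<^sup>+ s. w s \<partial>lborel) * v (snd x 0, seen_from 0 x) = (\<integral>\<^sup>+ s. \<Phi> s x \<partial>lborel)"
      unfolding \<Phi>_def by (subst nn_integral_multc) auto
  qed
  also have "\<dots> = (\<integral>\<^sup>+ s. (\<integral>\<^sup>+ x. \<Phi> s x \<partial>N) \<partial>lborel)"
    by (rule Fubini') measurable
  also have "\<dots> = (\<integral>\<^sup>+ s. (\<integral>\<^sup>+ x. \<Phi> s (theta s x) \<partial>N) \<partial>lborel)"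
    by (intro nn_integral_cong nn_integral_theta[symmetric]) measurable
  also have "\<dots> = (\<integral>\<^sup>+ x. (\<integral>\<^sup>+ s. \<Phi> s (theta s x) \<partial>lborel) \<partial>N)"
    by (rule Fubini'[symmetric]) (rule \<Phi>\<theta>)
  also have "\<dots> = (\<integral>\<^sup>+ x. (\<integral>\<^sup>+ n. w (snd x (n + j)) *
        (\<integral>\<^sup>+ u. v (u, seen_from n x) * indicator {0..<cycle_length (snd x) n} u \<partial>lborel)
      \<partial>count_space UNIV) \<partial>N)"
  proof (rule nn_integral_cong)
    fix x assume x: "x \<in> space N"
    obtain z p where zp: "x = (z, p)" by (cases x)
    with x have z: "z \<in> H_space" and p: "p \<in> L_space" by (auto simp: space_law)
    have sp [measurable]: "seen_from n x \<in> space HL_measure" for n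
      using x theta_in_space by (simp add: seen_from_def sets_eq_imp_space_eq[OF sets_law])
    define g where "g n s = w (p (n + j)) * v (p n - s, seen_from n x)" for n s
    have g: "g n \<in> borel_measurable borel" for n
      unfolding g_def by measurable
    have vu: "(\<lambda>u. v (u, seen_from n x)) \<in> borel_measurable borel" for n
      by measurable
    \<comment> \<open>Along a cycle the shifted integrand depends on \<open>s\<close> only through the distance \<open>p n - s\<close>:
      the \<open>s\<close> added in the argument of \<open>w\<close> cancels the shift of the point.\<close>
    have "(\<integral>\<^sup>+ s. \<Phi> s (theta s x) \<partial>lborel) = (\<integral>\<^sup>+ s. g (cycle_index p s) s \<partial>lborel)"
      by (simp add: \<Phi>_def g_def zp snd_theta seen_from_theta[OF z p])
    also have "\<dots> = (\<integral>\<^sup>+ n. (\<integral>\<^sup>+ u. g n (p n - u) * indicator {0..<cycle_length p n} u \<partial>lborel)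
        \<partial>count_space UNIV)"
      by (rule nn_integral_cut_at_cycles[OF p g])
    also have "\<dots> = (\<integral>\<^sup>+ n. w (snd x (n + j)) *
        (\<integral>\<^sup>+ u. v (u, seen_from n x) * indicator {0..<cycle_length (snd x) n} u \<partial>lborel)
      \<partial>count_space UNIV)"
    proof (rule nn_integral_cong)
      fix n
      show "(\<integral>\<^sup>+ u. g n (p n - u) * indicator {0..<cycle_length p n} u \<partial>lborel) =
          w (snd x (n + j)) *
            (\<integral>\<^sup>+ u. v (u, seen_from n x) * indicator {0..<cycle_length (snd x) n} u \<partial>lborel)"
        using vu[of n]
        by (subst nn_integral_cmult[symmetric]) (auto simp: g_def zp mult.assoc)
    qed
    finally show "(\<integral>\<^sup>+ s. \<Phi> s (theta s x) \<partial>lborel) = (\<integral>\<^sup>+ n. w (snd x (n + j)) *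
        (\<integral>\<^sup>+ u. v (u, seen_from n x) * indicator {0..<cycle_length (snd x) n} u \<partial>lborel)
      \<partial>count_space UNIV)" .
  qed
  finally show ?thesis .
qed

section \<open>The Campbell formula\<close>

text \<open>
  Dividing by the cycle length turns the integral over a cycle into a plain value, so the
  exchange formula counts each cycle once. The sum is over the cycles \<open>1, \<dots>, N\<^sub>t\<close>, and the cycle \<open>k\<close>
  is among them exactly when its left end \<open>P\<^bsub>k-1\<^esub>\<close> lies in \<open>[0,t)\<close>, whereas its right end may
  exceed \<open>t\<close>. This is why the window tests the left end, that is, \<open>j = -1\<close>.
\<close>

theorem campbell_formula:
  assumes t: "0 \<le> t" and f [measurable]: "f \<in> borel_measurable HL_measure"
  shows "(\<integral>\<^sup>+ x. (\<Sum>k\<in>{1..cycle_index (snd x) t}. f (seen_from k x)) \<partial>N) =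
    ennreal t * (\<integral>\<^sup>+ x. f (seen_from 0 x) / ennreal (cycle_length (snd x) 0) \<partial>N)"
proof -
  define w where "w = (indicator {0..<t} :: real \<Rightarrow> ennreal)"
  define v where "v = (\<lambda>(u :: real, x). f x / ennreal (cycle_length (snd x) 0))"
  have "ennreal t * (\<integral>\<^sup>+ x. f (seen_from 0 x) / ennreal (cycle_length (snd x) 0) \<partial>N) =
      (\<integral>\<^sup>+ s. w s \<partial>lborel) * (\<integral>\<^sup>+ x. v (snd x 0, seen_from 0 x) \<partial>N)"
  proof (intro arg_cong2[where f = "(*)"] nn_integral_cong)
    show "ennreal t = (\<integral>\<^sup>+ s. w s \<partial>lborel)"
      using t by (simp add: w_def)
    show "f (seen_from 0 x) / ennreal (cycle_length (snd x) 0) = v (snd x 0, seen_from 0 x)"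
      if "x \<in> space N" for x
      using that by (cases x) (auto simp: v_def space_law cycle_length_seen_from)
  qed
  also have "\<dots> = (\<integral>\<^sup>+ x. (\<integral>\<^sup>+ n. w (snd x (n + (-1))) *
        (\<integral>\<^sup>+ u. v (u, seen_from n x) * indicator {0..<cycle_length (snd x) n} u \<partial>lborel)
      \<partial>count_space UNIV) \<partial>N)"
    by (rule cycle_exchange) (auto simp: w_def v_def)
  also have "\<dots> = (\<integral>\<^sup>+ x. (\<Sum>k\<in>{1..cycle_index (snd x) t}. f (seen_from k x)) \<partial>N)"
  proof (rule nn_integral_cong)
    fix x assume "x \<in> space N"
    then obtain z p where x: "x = (z, p)" and p: "p \<in> L_space"
      by (cases x) (auto simp: space_law)
    have mono: "strict_mono p" and p0: "p (-1) < 0" "0 \<le> p 0"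
      using p by (auto simp: L_space_def)
    have V: "(\<integral>\<^sup>+ u. v (u, seen_from n x) * indicator {0..<cycle_length (snd x) n} u \<partial>lborel) =
        f (seen_from n x)" for n
    proof -
      have "(\<integral>\<^sup>+ u. v (u, seen_from n x) * indicator {0..<cycle_length (snd x) n} u \<partial>lborel) =
          f (seen_from n x) / ennreal (cycle_length p n) * ennreal (cycle_length p n)"
        using cycle_length_pos[OF p, of n]
        by (simp add: v_def x cycle_length_seen_from[OF p] nn_integral_cmult_indicator)
      also have "\<dots> = f (seen_from n x)"
        using cycle_length_pos[OF p, of n]
        by (simp add: ennreal_divide_times ennreal_times_divide mult_divide_eq_ennreal)
      finally show ?thesis .
    qed
    have pt: "p (n - 1) \<in> {0..<t} \<longleftrightarrow> n \<in> {1..cycle_index p t}" for n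
    proof -
      define m where "m = cycle_index p t"
      have m: "p (m - 1) < t" "t \<le> p m"
        using cycle_index_eq_iff[OF p, of t m] by (auto simp: m_def)
      have "0 \<le> p (n - 1) \<longleftrightarrow> 1 \<le> n"
      proof
        assume "0 \<le> p (n - 1)"
        then have "p (-1) < p (n - 1)" using p0 by linarith
        then show "1 \<le> n" using strict_mono_less[OF mono] by simp
      next
        assume "1 \<le> n"
        then have "p 0 \<le> p (n - 1)" using strict_mono_less_eq[OF mono] by simp
        then show "0 \<le> p (n - 1)" using p0 by linarith
      qed
      moreover have "p (n - 1) < t \<longleftrightarrow> n \<le> m"
      proof
        assume "p (n - 1) < t"
        then have "p (n - 1) < p m" using m by linarith
        then show "n \<le> m" using strict_mono_less[OF mono] by simp
      next
        assume "n \<le> m"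
        then have "p (n - 1) \<le> p (m - 1)" using strict_mono_less_eq[OF mono] by simp
        then show "p (n - 1) < t" using m by linarith
      qed
      ultimately show ?thesis by (simp add: m_def)
    qed
    have "(\<integral>\<^sup>+ n. w (snd x (n + (-1))) *
        (\<integral>\<^sup>+ u. v (u, seen_from n x) * indicator {0..<cycle_length (snd x) n} u \<partial>lborel)
      \<partial>count_space UNIV) =
        (\<integral>\<^sup>+ n. f (seen_from n x) * indicator {1..cycle_index p t} n \<partial>count_space UNIV)"
      unfolding V using pt by (intro nn_integral_cong) (auto simp: w_def x indicator_def)
    also have "\<dots> = (\<Sum>k\<in>{1..cycle_index p t}. f (seen_from k x))"
      by (simp add: nn_integral_count_space_indicator[symmetric] nn_integral_count_space_finite)
    finally show "(\<integral>\<^sup>+ n. w (snd x (n + (-1))) *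
        (\<integral>\<^sup>+ u. v (u, seen_from n x) * indicator {0..<cycle_length (snd x) n} u \<partial>lborel)
      \<partial>count_space UNIV) = (\<Sum>k\<in>{1..cycle_index (snd x) t}. f (seen_from k x))"
      by (simp add: x)
  qed
  finally show ?thesis ..
qed

section \<open>The position of the origin in its cycle\<close>

text \<open>
  Inside each cycle, given what is seen from its right end, a time chosen according to
  Lebesgue measure has a uniform relative position. So the indicator of \<open>A\<close> may be replaced by its
  average \<open>\<lambda>(A \<inter> [0,1))\<close> on the right of the exchange formula, and reading the formula backwards
  gives the product.
\<close>

theorem rel_pos_factorises:
  assumes A [measurable]: "A \<in> sets borel" and B [measurable]: "B \<in> sets HL_measure"
  shows "(\<integral>\<^sup>+ x. indicator A (rel_pos (snd x) 0) * indicator B (seen_from 0 x) \<partial>N) =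
    emeasure lborel (A \<inter> {0..<1}) * (\<integral>\<^sup>+ x. indicator B (seen_from 0 x) \<partial>N)"
proof -
  \<comment> \<open>Any window of total mass \<open>1\<close> serves here.\<close>
  define w where "w = (indicator {0..<1} :: real \<Rightarrow> ennreal)"
  define v where "v = (\<lambda>(u :: real, x). indicator A (1 - u / cycle_length (snd x) 0) *
    (indicator B x :: ennreal))"
  define v' where "v' = (\<lambda>(u :: real, x). emeasure lborel (A \<inter> {0..<1}) * (indicator B x :: ennreal))"
  have int_w: "(\<integral>\<^sup>+ s. w s \<partial>lborel) = 1"
    by (simp add: w_def)
  have "(\<integral>\<^sup>+ x. indicator A (rel_pos (snd x) 0) * indicator B (seen_from 0 x) \<partial>N) =
      (\<integral>\<^sup>+ x. v (snd x 0, seen_from 0 x) \<partial>N)"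
    by (intro nn_integral_cong) (auto simp: space_law v_def rel_pos_zero cycle_length_seen_from)
  also have "\<dots> = (\<integral>\<^sup>+ x. (\<integral>\<^sup>+ n. w (snd x (n + 0)) *
        (\<integral>\<^sup>+ u. v (u, seen_from n x) * indicator {0..<cycle_length (snd x) n} u \<partial>lborel)
      \<partial>count_space UNIV) \<partial>N)"
    using cycle_exchange[of w v 0] by (auto simp: w_def v_def)
  also have "\<dots> = (\<integral>\<^sup>+ x. (\<integral>\<^sup>+ n. w (snd x (n + 0)) *
        (\<integral>\<^sup>+ u. v' (u, seen_from n x) * indicator {0..<cycle_length (snd x) n} u \<partial>lborel)
      \<partial>count_space UNIV) \<partial>N)"
  proof (rule nn_integral_cong, rule nn_integral_cong, rule arg_cong[where f = "(*) _"])
    fix x and n :: int assume "x \<in> space N"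
    then obtain z p where x: "x = (z, p)" and p: "p \<in> L_space"
      by (cases x) (auto simp: space_law)
    define l where "l = cycle_length p n"
    have l: "0 < l" using cycle_length_pos[OF p] by (simp add: l_def)
    let ?b = "indicator B (seen_from n x) :: ennreal"
    have "(\<integral>\<^sup>+ u. v (u, seen_from n x) * indicator {0..<cycle_length (snd x) n} u \<partial>lborel) =
        (\<integral>\<^sup>+ u. ?b * (indicator A (1 - u / l) * indicator {0..<l} u) \<partial>lborel)"
      by (simp add: v_def x cycle_length_seen_from[OF p] l_def mult_ac)
    also have "\<dots> = ?b * (\<integral>\<^sup>+ u. indicator A (1 - u / l) * indicator {0..<l} u \<partial>lborel)"
      by (rule nn_integral_cmult) measurable
    also have "\<dots> = ?b * (ennreal l * emeasure lborel (A \<inter> {0..<1}))"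
      using A l by (simp only: nn_integral_rescaled_cycle)
    also have "\<dots> = (?b * emeasure lborel (A \<inter> {0..<1})) * (\<integral>\<^sup>+ u. indicator {0..<l} u \<partial>lborel)"
      using l by (simp add: mult_ac)
    also have "\<dots> = (\<integral>\<^sup>+ u. ?b * emeasure lborel (A \<inter> {0..<1}) * indicator {0..<l} u \<partial>lborel)"
      by (rule nn_integral_cmult[symmetric]) measurable
    also have "\<dots> =
        (\<integral>\<^sup>+ u. v' (u, seen_from n x) * indicator {0..<cycle_length (snd x) n} u \<partial>lborel)"
      by (simp add: v'_def x l_def mult_ac)
    finally show "(\<integral>\<^sup>+ u. v (u, seen_from n x) * indicator {0..<cycle_length (snd x) n} u \<partial>lborel) =
        (\<integral>\<^sup>+ u. v' (u, seen_from n x) * indicator {0..<cycle_length (snd x) n} u \<partial>lborel)" .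
  qed
  also have "\<dots> = (\<integral>\<^sup>+ x. v' (snd x 0, seen_from 0 x) \<partial>N)"
    using cycle_exchange[of w v' 0] by (auto simp: w_def v'_def)
  also have "\<dots> = emeasure lborel (A \<inter> {0..<1}) * (\<integral>\<^sup>+ x. indicator B (seen_from 0 x) \<partial>N)"
    by (simp add: v'_def nn_integral_cmult)
  finally show ?thesis .
qed

end

section \<open>Transfer to a random element\<close>

text \<open>
  On \<open>L_space\<close> the index in the definition of the relative position of \<open>0\<close> is the constant \<open>0\<close>,
  which leaves a continuous function of two coordinates.
\<close>

lemma measurable_rel_pos_zero: "(\<lambda>s. rel_pos s 0) \<in> borel_measurable L_measure"
proof -
  have "(\<lambda>s. 1 - s 0 / cycle_length s 0) \<in> borel_measurable L_measure"
    by measurable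
  then show ?thesis
    by (rule measurable_cong[THEN iffD2, rotated]) (simp add: space_L_measure rel_pos_zero)
qed

lemma Int_stable_preimages: "Int_stable {Z -` A \<inter> space M | A. A \<in> sets R}"
proof (rule Int_stableI)
  fix a b assume "a \<in> {Z -` A \<inter> space M | A. A \<in> sets R}" "b \<in> {Z -` A \<inter> space M | A. A \<in> sets R}"
  then obtain A B where "A \<in> sets R" "B \<in> sets R" "a = Z -` A \<inter> space M" "b = Z -` B \<inter> space M"
    by auto
  then show "a \<inter> b \<in> {Z -` A \<inter> space M | A. A \<in> sets R}"
    by (intro CollectI exI[of _ "A \<inter> B"]) auto
qed

text \<open>
  The preimages under a random variable are stable under intersection, so the product rule
  for single preimages suffices.
\<close>

lemma (in prob_space) indep_rvsI:
  assumes X: "X \<in> measurable M S" and Y: "Y \<in> measurable M T"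
    and prod: "\<And>A B. A \<in> sets S \<Longrightarrow> B \<in> sets T \<Longrightarrow>
      prob (X -` A \<inter> Y -` B \<inter> space M) = prob (X -` A \<inter> space M) * prob (Y -` B \<inter> space M)"
  shows "indep_rvs M S X T Y"
proof -
  have "indep_set {X -` A \<inter> space M | A. A \<in> sets S} {Y -` A \<inter> space M | A. A \<in> sets T}"
    unfolding indep_sets2_eq
  proof safe
    fix A B assume AB: "A \<in> sets S" "B \<in> sets T"
    have "X -` A \<inter> space M \<inter> (Y -` B \<inter> space M) = X -` A \<inter> Y -` B \<inter> space M" by auto
    then show "prob (X -` A \<inter> space M \<inter> (Y -` B \<inter> space M)) =
        prob (X -` A \<inter> space M) * prob (Y -` B \<inter> space M)"
      using prod[OF AB] by simp
  qed (use X Y in \<open>auto intro: measurable_sets\<close>)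
  then show ?thesis
    unfolding indep_rvs_def using X Y by (auto intro!: indep_set_sigma_sets Int_stable_preimages)
qed

theorem theorem4p5:
  fixes M :: "'a measure"
    and K :: "'a \<Rightarrow> real \<Rightarrow> real"
    and P :: "'a \<Rightarrow> int \<Rightarrow> real"
  assumes "prob_space M"
    and "(\<lambda>\<omega>. (K \<omega>, P \<omega>)) \<in> measurable M HL_measure"
    and "space_homogeneous_stationary M K P"
  shows "(\<forall>\<omega>\<in>space M. theta (P \<omega> 0) (K \<omega>, P \<omega>) =
           (\<lambda>t. K \<omega> (t + P \<omega> 0) - K \<omega> (P \<omega> 0), \<lambda>k. P \<omega> k - P \<omega> 0)) \<and>
         distr M borel (\<lambda>\<omega>. rel_pos (P \<omega>) 0) = uniform_measure lborel {0..<1} \<and>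
         indep_rvs M borel (\<lambda>\<omega>. rel_pos (P \<omega>) 0) HL_measure (\<lambda>\<omega>. theta (P \<omega> 0) (K \<omega>, P \<omega>)) \<and>
         (\<forall>t\<ge>0. \<forall>f :: (real \<Rightarrow> real) \<times> (int \<Rightarrow> real) \<Rightarrow> ennreal. f \<in> borel_measurable HL_measure \<longrightarrow>
           (\<integral>\<^sup>+ \<omega>. (\<Sum>k\<in>{1..cycle_index (P \<omega>) t}. f (theta (P \<omega> k) (K \<omega>, P \<omega>))) \<partial>M) =
           ennreal t * (\<integral>\<^sup>+ \<omega>. f (theta (P \<omega> 0) (K \<omega>, P \<omega>)) / ennreal (cycle_length (P \<omega>) 0) \<partial>M))"
proof -
  interpret prob_space M by fact
  define X where "X = (\<lambda>\<omega>. (K \<omega>, P \<omega>))"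
  have X [measurable]: "X \<in> measurable M HL_measure"
    unfolding X_def by fact
  define N where "N = distr M HL_measure X"
  have PL: "P \<omega> \<in> L_space" if "\<omega> \<in> space M" for \<omega>
    using measurable_space[OF X that]
    by (simp add: X_def space_pair_measure space_L_measure)
  have seen: "theta (P \<omega> k) (K \<omega>, P \<omega>) = seen_from k (X \<omega>)" for k \<omega>
    by (simp add: seen_from_def X_def)
  have snd_X: "snd (X \<omega>) = P \<omega>" for \<omega>
    by (simp add: X_def)
  interpret N: stationary_law N
  proof (intro stationary_law.intro stationary_law_axioms.intro)
    show "prob_space N"
      unfolding N_def by (rule prob_space_distr) (rule X)
    show "sets N = sets HL_measure"
      by (simp add: N_def)
    fix t
    have "distr N HL_measure (theta t) = distr M HL_measure (\<lambda>\<omega>. theta t (X \<omega>))"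
      unfolding N_def by (subst distr_distr) (auto simp: measurable_theta comp_def)
    also have "\<dots> = N"
      using assms(3) by (simp add: space_homogeneous_stationary_def N_def X_def)
    finally show "distr N HL_measure (theta t) = N" .
  qed
  have transfer: "(\<integral>\<^sup>+ x. g x \<partial>N) = (\<integral>\<^sup>+ \<omega>. g (X \<omega>) \<partial>M)"
    if "g \<in> borel_measurable HL_measure" for g :: "_ \<Rightarrow> ennreal"
    unfolding N_def using that by (intro nn_integral_distr) auto
  define U where "U = (\<lambda>\<omega>. rel_pos (P \<omega>) 0)"
  have [measurable]: "(\<lambda>x. rel_pos (snd x) 0) \<in> borel_measurable HL_measure"
    by (rule measurable_compose[OF measurable_snd measurable_rel_pos_zero])
  have U [measurable]: "U \<in> borel_measurable M"
    using measurable_compose[OF X, of "\<lambda>x. rel_pos (snd x) 0" borel] by (simp add: U_def snd_X)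
  define Y where "Y = (\<lambda>\<omega>. seen_from 0 (X \<omega>))"
  have Y [measurable]: "Y \<in> measurable M HL_measure"
    unfolding Y_def by measurable
  \<comment> \<open>With \<open>B\<close> the whole space this is the uniform law; in general it then is independence.\<close>
  have joint: "emeasure M (U -` A \<inter> Y -` B \<inter> space M) =
      emeasure lborel (A \<inter> {0..<1}) * emeasure M (Y -` B \<inter> space M)"
    if A [measurable]: "A \<in> sets borel" and B [measurable]: "B \<in> sets HL_measure" for A B
  proof -
    have sets: "U -` A \<inter> space M \<in> sets M" "Y -` B \<inter> space M \<in> sets M"
      by (auto intro: measurable_sets U Y)
    have "U -` A \<inter> Y -` B \<inter> space M = (U -` A \<inter> space M) \<inter> (Y -` B \<inter> space M)" by auto
    then have "emeasure M (U -` A \<inter> Y -` B \<inter> space M) =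
        (\<integral>\<^sup>+ \<omega>. indicator ((U -` A \<inter> space M) \<inter> (Y -` B \<inter> space M)) \<omega> \<partial>M)"
      using sets by simp
    also have "\<dots> = (\<integral>\<^sup>+ \<omega>. indicator A (rel_pos (snd (X \<omega>)) 0) * indicator B (seen_from 0 (X \<omega>)) \<partial>M)"
      by (intro nn_integral_cong) (auto simp: U_def Y_def snd_X indicator_def)
    also have "\<dots> = (\<integral>\<^sup>+ x. indicator A (rel_pos (snd x) 0) * indicator B (seen_from 0 x) \<partial>N)"
      by (rule transfer[symmetric]) measurable
    also have "\<dots> = emeasure lborel (A \<inter> {0..<1}) * (\<integral>\<^sup>+ x. indicator B (seen_from 0 x) \<partial>N)"
      by (rule N.rel_pos_factorises) fact+
    also have "(\<integral>\<^sup>+ x. indicator B (seen_from 0 x) \<partial>N) = (\<integral>\<^sup>+ \<omega>. indicator B (seen_from 0 (X \<omega>)) \<partial>M)"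
      by (rule transfer) measurable
    also have "\<dots> = (\<integral>\<^sup>+ \<omega>. indicator (Y -` B \<inter> space M) \<omega> \<partial>M)"
      by (intro nn_integral_cong) (auto simp: Y_def indicator_def)
    also have "\<dots> = emeasure M (Y -` B \<inter> space M)"
      using sets by simp
    finally show ?thesis .
  qed
  have law_U: "emeasure M (U -` A \<inter> space M) = emeasure lborel (A \<inter> {0..<1})"
    if "A \<in> sets borel" for A
  proof -
    have Y_space: "Y -` space HL_measure \<inter> space M = space M"
      using measurable_space[OF Y] by auto
    then have "U -` A \<inter> Y -` space HL_measure \<inter> space M = U -` A \<inter> space M" by auto
    then show ?thesis
      using joint[OF that sets.top] Y_space by (simp add: emeasure_space_1)
  qed
  have "distr M borel U = uniform_measure lborel {0..<1}"
    by (rule measure_eqI)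
      (simp_all add: emeasure_distr law_U emeasure_uniform_measure Int_commute[of "{0..<1}"] divide_ennreal_def)
  moreover have "indep_rvs M borel U HL_measure Y"
  proof (rule indep_rvsI[OF U Y])
    fix A B assume AB: "A \<in> sets (borel :: real measure)" "B \<in> sets HL_measure"
    show "prob (U -` A \<inter> Y -` B \<inter> space M) = prob (U -` A \<inter> space M) * prob (Y -` B \<inter> space M)"
      using joint[OF AB] law_U[OF AB(1)] by (simp add: measure_def enn2real_mult)
  qed
  moreover have "theta (P \<omega> 0) (K \<omega>, P \<omega>) =
      (\<lambda>t. K \<omega> (t + P \<omega> 0) - K \<omega> (P \<omega> 0), \<lambda>k. P \<omega> k - P \<omega> 0)" if "\<omega> \<in> space M" for \<omega>
    using seen_from_eq[OF PL[OF that], of 0 "K \<omega>"] by (simp add: seen_from_def add.commute)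
  moreover have "(\<integral>\<^sup>+ \<omega>. (\<Sum>k\<in>{1..cycle_index (P \<omega>) t}. f (theta (P \<omega> k) (K \<omega>, P \<omega>))) \<partial>M) =
      ennreal t * (\<integral>\<^sup>+ \<omega>. f (theta (P \<omega> 0) (K \<omega>, P \<omega>)) / ennreal (cycle_length (P \<omega>) 0) \<partial>M)"
    if "0 \<le> t" and f [measurable]: "f \<in> borel_measurable HL_measure"
    for t and f :: "_ \<Rightarrow> ennreal"
  proof -
    have "(\<lambda>x. \<Sum>k\<in>{1..n}. f (seen_from k x)) \<in> borel_measurable HL_measure" for n :: int
      by measurable
    moreover have "(\<lambda>x. cycle_index (snd x) t) \<in> measurable HL_measure (count_space UNIV)"
      by (rule measurable_compose[OF measurable_snd measurable_cycle_index])
    ultimately have sum: "(\<lambda>x. \<Sum>k\<in>{1..cycle_index (snd x) t}. f (seen_from k x))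
        \<in> borel_measurable HL_measure"
      by (rule measurable_compose_countable[where f = "\<lambda>n x. \<Sum>k\<in>{1..n}. f (seen_from k x)"])
    have ratio: "(\<lambda>x. f (seen_from 0 x) / ennreal (cycle_length (snd x) 0)) \<in> borel_measurable HL_measure"
      by measurable
    show ?thesis
      using N.campbell_formula[OF that]
      unfolding transfer[OF sum] transfer[OF ratio] by (simp only: snd_X seen)
  qed
  ultimately show ?thesis
    unfolding U_def Y_def seen by blast
qed

end
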